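(* Let $\mathbb{K}$ be a field of characteristic zero, let $f_1(t),f_2(t)$ be delta series over $\mathbb{K}$, let $(\widetilde s_n^{(1)}(x))_{n\ge 0}$ and $(\widetilde s_n^{(2)}(x))_{n\ge0}$ be the associated Sheffer sequences for $f_1(t)$ and $f_2(t)$ respectively, and let $(\widetilde s_n^{[2]}(x))_{n\ge0}$ be the 2-iterated associated Sheffer polynomials, i.e. $\widetilde s_n^{[2]}(x)$ is obtained from $\widetilde s_n^{(1)}(x)$ by replacing each power $x^k$ by $\widetilde s_k^{(2)}(x)$. Then $$\exp\bigl(x\,\bar f_2(\bar f_1(t))\bigr)=\sum_{n=0}^\infty \widetilde s_n^{[2]}(x)\frac{t^n}{n!}.$$
   Context: A formal power series $f(t)=\sum_{n\ge0}f_nt^n/n!$ over $\mathbb{K}$ is a delta series if $f_0=0$ and $f_1\neq 0$; then $\bar f(t)$ denotes its compositional inverse, $f(\bar f(t))=\bar f(f(t))=t$. The associated Sheffer sequence $(\widetilde s_n(x))_{n\ge0}$ for $f(t)$ is the polynomial sequence determined by $$e^{x\bar f(t)}=\sum_{n=0}^\infty \widetilde s_n(x)\frac{t^n}{n!}.$$ If $\widetilde s_n^{(1)}(x)=\sum_{k=0}^n b_{n,k}x^k$, the 2-iterated associated Sheffer polynomials are $\widetilde s_n^{[2]}(x)=\sum_{k=0}^n b_{n,k}\widetilde s_k^{(2)}(x)$. *)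

theory Defs
  imports "HOL-Computational_Algebra.Computational_Algebra"
begin

text \<open>
  Identities between power series in \<open>t\<close> whose coefficients are polynomials in \<open>x\<close> over a
  field \<open>K\<close> of characteristic zero are stated in \<open>K[x][[t]]\<close>, i.e. in the type \<open>'a poly fps\<close>:
  \<open>t\<close> is the series variable and \<open>x\<close> is the coefficient \<open>[:0, 1:]\<close>.
\<close>

text \<open>
  With \<open>f = (\<Sum>n. f\<^sub>n t^n / n!)\<close>, the ordinary coefficients \<open>f $ 0\<close> and \<open>f $ 1\<close> are \<open>f\<^sub>0\<close> and
  \<open>f\<^sub>1\<close>.  For a delta series, \<open>fps_inv f\<close> is the two-sided compositional inverse
  (\<open>fps_inv\<close>, \<open>fps_inv_right\<close>).
\<close>

definition delta_series :: "'a::field_char_0 fps \<Rightarrow> bool" where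
  "delta_series f \<longleftrightarrow> fps_nth f 0 = 0 \<and> fps_nth f 1 \<noteq> 0"

text \<open>The inclusion of \<open>K[[t]]\<close> into \<open>K[x][[t]]\<close>.\<close>

definition fps_lift :: "'a::zero fps \<Rightarrow> 'a poly fps" where
  "fps_lift f = Abs_fps (\<lambda>n. [:fps_nth f n:])"

text \<open>
  \<open>exp(G) = (\<Sum>k. G^k / k!)\<close> for \<open>G \<in> K[x][[t]]\<close> with zero constant term; as for \<open>fps_compose\<close>,
  the value is meaningless otherwise.  The library's \<open>fps_exp\<close> does not apply directly, since
  \<open>K[x]\<close> is not a field.
\<close>

definition fps_poly_exp :: "'a::field_char_0 poly fps \<Rightarrow> 'a poly fps" where
  "fps_poly_exp G = fps_lift (fps_exp 1) oo G"

text \<open>The series \<open>exp(x g(t))\<close>.\<close>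

definition exp_x_times :: "'a::field_char_0 fps \<Rightarrow> 'a poly fps" where
  "exp_x_times g = fps_poly_exp (fps_const [:0, 1:] * fps_lift g)"

text \<open>The exponential generating function \<open>\<Sum>n. s\<^sub>n(x) t^n / n!\<close>.\<close>

definition poly_egf :: "(nat \<Rightarrow> 'a::field_char_0 poly) \<Rightarrow> 'a poly fps" where
  "poly_egf s = Abs_fps (\<lambda>n. smult (1 / fact n) (s n))"

definition associated_sheffer :: "'a::field_char_0 fps \<Rightarrow> (nat \<Rightarrow> 'a poly) \<Rightarrow> bool" where
  "associated_sheffer f s \<longleftrightarrow> exp_x_times (fps_inv f) = poly_egf s"

definition iterated_associated_sheffer ::
    "(nat \<Rightarrow> 'a::field_char_0 poly) \<Rightarrow> (nat \<Rightarrow> 'a poly) \<Rightarrow> nat \<Rightarrow> 'a poly" where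
  "iterated_associated_sheffer s1 s2 n = (\<Sum>k=0..n. smult (coeff (s1 n) k) (s2 k))"

end

theory Submission
  imports Defs
begin

text \<open>
  If \<open>g\<close> has zero constant term, the coefficient of \<open>x\<^sup>i t\<^sup>n\<close> in \<open>exp(x g(t))\<close> is \<open>[t\<^sup>n] g(t)\<^sup>i / i!\<close>.
  Write \<open>g\<^sub>1\<close>, \<open>g\<^sub>2\<close> for the compositional inverses of the two delta series.  In these coordinates
  the umbral substitution of \<open>s2 k\<close> for \<open>x\<^sup>k\<close> is a matrix product: the factors \<open>k!\<close> from the two
  generating functions cancel, and the coefficient of \<open>x\<^sup>i t\<^sup>n\<close> in the generating function of the
  iterated sequence is
  \[ \frac{1}{i!} \sum_k [t^k] g_2(t)^i \cdot [t^n] g_1(t)^k . \]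
  The sum is the \<open>n\<close>-th coefficient of \<open>g\<^sub>2\<^sup>i \<circ> g\<^sub>1\<close>.  Since substitution of \<open>g\<^sub>1\<close> is a ring
  homomorphism, this series is \<open>(g\<^sub>2 \<circ> g\<^sub>1)\<^sup>i\<close>, so the coefficient agrees with that of
  \<open>exp(x g\<^sub>2(g\<^sub>1(t)))\<close>.
\<close>

lemma fps_lift_1: "fps_lift 1 = (1 :: 'a::comm_semiring_1 poly fps)"
  by (rule fps_ext) (simp add: fps_lift_def one_pCons)

lemma fps_lift_mult:
  fixes f g :: "'a::comm_semiring_1 fps"
  shows "fps_lift (f * g) = fps_lift f * fps_lift g"
proof (rule fps_ext)
  fix n
  have const_sum: "[:sum h A:] = (\<Sum>i\<in>A. [:h i:])" for h :: "nat \<Rightarrow> 'a" and A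
    by (rule poly_eqI) (simp add: coeff_sum coeff_pCons split: nat.split)
  show "fps_lift (f * g) $ n = (fps_lift f * fps_lift g) $ n"
    by (simp add: fps_lift_def fps_mult_nth const_sum ac_simps)
qed

lemma fps_lift_power:
  fixes f :: "'a::comm_semiring_1 fps"
  shows "fps_lift (f ^ k) = fps_lift f ^ k"
  by (induction k) (simp_all add: fps_lift_1 fps_lift_mult)

text \<open>
  The definition of composition cuts the exponential sum off at \<open>k = n\<close>; since \<open>g $ 0 = 0\<close> makes
  \<open>g ^ i $ n\<close> vanish for \<open>i > n\<close>, the formula holds for every \<open>i\<close>.
\<close>

lemma coeff_exp_x_times:
  fixes g :: "'a::field_char_0 fps"
  assumes "g $ 0 = 0"
  shows "coeff (exp_x_times g $ n) i = g ^ i $ n / fact i"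
proof -
  have "(fps_const [:0, 1:] * fps_lift g) ^ k $ n = monom (g ^ k $ n) k" for k
    by (simp add: power_mult_distrib fps_const_power flip: fps_lift_power)
       (simp add: fps_lift_def smult_monom monom_altdef)
  then have "exp_x_times g $ n = (\<Sum>k=0..n. monom (g ^ k $ n / fact k) k)"
    by (simp add: exp_x_times_def fps_poly_exp_def fps_compose_nth smult_monom)
       (simp add: fps_lift_def smult_monom)
  then have "coeff (exp_x_times g $ n) i = (if i \<le> n then g ^ i $ n / fact i else 0)"
    by (simp add: coeff_sum)
  then show ?thesis
    using startsby_zero_power_prefix[OF assms, of i] by auto
qed

lemma coeff_associated_sheffer:
  fixes f :: "'a::field_char_0 fps"
  assumes "associated_sheffer f s"
  shows "coeff (s n) i = fact n * (fps_inv f ^ i $ n / fact i)"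
proof -
  have "exp_x_times (fps_inv f) $ n = smult (1 / fact n) (s n)"
    using assms by (simp add: associated_sheffer_def poly_egf_def)
  moreover have "fps_inv f $ 0 = 0"
    by (simp add: fps_inv_def)
  ultimately have "coeff (s n) i / fact n = fps_inv f ^ i $ n / fact i"
    using coeff_exp_x_times[of "fps_inv f" n i] by simp
  then show ?thesis
    by (simp add: field_simps)
qed

theorem corollary2p1:
  fixes f1 f2 :: "'a::field_char_0 fps"
    and s1 s2 :: "nat \<Rightarrow> 'a poly"
  assumes "delta_series f1" and "delta_series f2"
    and "associated_sheffer f1 s1" and "associated_sheffer f2 s2"
  shows "exp_x_times (fps_inv f2 oo fps_inv f1) = poly_egf (iterated_associated_sheffer s1 s2)"
proof (rule fps_ext, rule poly_eqI)
  fix n i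
  have zero: "fps_inv f1 $ 0 = 0" "fps_inv f2 $ 0 = 0"
    by (simp_all add: fps_inv_def)
  then have "(fps_inv f2 oo fps_inv f1) $ 0 = 0"
    by simp
  then have "coeff (exp_x_times (fps_inv f2 oo fps_inv f1) $ n) i =
      (fps_inv f2 oo fps_inv f1) ^ i $ n / fact i"
    by (rule coeff_exp_x_times)
  also have "\<dots> = (\<Sum>k=0..n. fps_inv f2 ^ i $ k * fps_inv f1 ^ k $ n) / fact i"
    by (simp add: fps_compose_power[OF zero(1)] fps_compose_nth)
  also have "\<dots> = (\<Sum>k=0..n. coeff (s1 n) k * coeff (s2 k) i) / fact n"
    by (simp add: coeff_associated_sheffer[OF assms(3)] coeff_associated_sheffer[OF assms(4)]
        sum_divide_distrib mult.commute)
  also have "\<dots> = coeff (poly_egf (iterated_associated_sheffer s1 s2) $ n) i"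
    by (simp add: poly_egf_def iterated_associated_sheffer_def coeff_sum)
  finally show "coeff (exp_x_times (fps_inv f2 oo fps_inv f1) $ n) i =
      coeff (poly_egf (iterated_associated_sheffer s1 s2) $ n) i" .
qed

end
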